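(* Let $k,m\ge 2$ be integers and $n=mk$. Let $A=(a_{i,j})_{1\le i,j\le k}\in M_k(\mathbb C)$ and $B_1,\dots,B_k\in M_m(\mathbb C)$ be complex Hadamard matrices, and let $H=(a_{i,j}B_j)_{1\le i,j\le k}\in M_n(\mathbb C)$ be the associated Dita type matrix, i.e. the block matrix whose $(i,j)$ block is $a_{i,j}B_j$. Then the second relative commutant of the subfactor $N_H\subset M_H$ associated to $H$, realized as the algebra $\mathcal D_n'\cap \mathcal Q_1\subset M_n(\mathbb C)\otimes M_n(\mathbb C)$, contains the projection $$f=\sum_{\substack{1\le i,j\le n\\ i\equiv j\ (\mathrm{mod}\ m)}} e_{i,i}\otimes e_{j,j}\in M_n(\mathbb C)\otimes M_n(\mathbb C)= M_{n^2}(\mathbb C).$$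
   Context: A complex Hadamard matrix is a matrix in $M_n(\mathbb C)$ all of whose entries have absolute value $1$ and whose rows are mutually orthogonal. The matrix $H$ above is itself an $n\times n$ complex Hadamard matrix; put $U=\frac1{\sqrt n}H$, a unitary. Rows and columns of $H$ are indexed so that, writing $i=(i_1-1)m+i_0$ and $j=(j_1-1)m+j_0$ with $1\le i_0,j_0\le m$ and $1\le i_1,j_1\le k$, the $(i,j)$ entry of $H$ is $a_{i_1,j_1}(B_{j_1})_{i_0,j_0}$. Let $(e_{i,j})_{1\le i,j\le n}$ be the matrix units of $M_n(\mathbb C)$ and $\mathcal D_n\subset M_n(\mathbb C)$ the algebra of diagonal matrices. Identify $M_n(\mathbb C)\otimes M_n(\mathbb C)$ with $M_{n^2}(\mathbb C)$ by letting $e_{k,l}\otimes e_{i,j}$ be the matrix with a single nonzero entry, equal to $1$, in row $(i-1)n+k$ and column $(j-1)n+l$. Embed $M_n(\mathbb C)$ in $M_n(\mathbb C)\otimes M_n(\mathbb C)$ by $x\mapsto x\otimes I_n$; in particular $\mathcal D_n$ and $U\mathcal D_nU^*$ are regarded as subalgebras of $M_n(\mathbb C)\otimes M_n(\mathbb C)$ in this way. To any $n\times n$ complex Hadamard matrix $H$ one associates the commuting square $\mathfrak C(H)$ with lower left corner $\mathbb C$, upper left corner $\mathcal D_n$, lower right corner $U\mathcal D_nU^*$ and upper right corner $M_n(\mathbb C)$ with its normalized trace. Let $e_3=\sum_{i=1}^n e_{i,i}\otimes e_{i,i}$. The basic construction of $\mathcal D_n\subset M_n(\mathbb C)$ is realized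 as $\mathcal P_1=\langle M_n(\mathbb C),e_3\rangle=M_n(\mathbb C)\otimes\mathcal D_n$ with Jones projection $e_3$, and $\mathcal Q_1\subset\mathcal P_1$ is the $*$-algebra generated by $U\mathcal D_nU^*$ and $e_3$. The subfactor $N_H\subset M_H$ associated to $H$ is the hyperfinite index $n$ inclusion of $II_1$ factors obtained by iterating Jones' basic construction on the flipped commuting square (with $\mathcal D_n$ and $U\mathcal D_nU^*$ interchanged), $N_H$ being the weak closure of the union of the lower row $\mathbb C\subset\mathcal D_n\subset\cdots$ and $M_H$ the weak closure of the union of the upper row $U\mathcal D_nU^*\subset M_n(\mathbb C)\subset\cdots$. Let $N_H\subset M_H\subset M_{H,1}$ be the basic construction. By Ocneanu's compactness theorem, the second relative commutant is $N_H'\cap M_{H,1}=\mathcal D_n'\cap\mathcal Q_1$, and this identification is the one used in the claim; here $\mathcal D_n'$ denotes the commutant of $\mathcal D_n=\mathcal D_n\otimes I_n$. *)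

theory Defs
  imports "Jordan_Normal_Form.Schur_Decomposition" "HOL-Number_Theory.Cong"
begin

text \<open>Row, column and block indices start at 0 throughout, so the mathematical index
  \<open>i \<in> {1..n}\<close> is represented by \<open>i - 1\<close>.\<close>

definition complex_hadamard :: "nat \<Rightarrow> complex mat \<Rightarrow> bool" where
  "complex_hadamard n H \<longleftrightarrow>
     H \<in> carrier_mat n n \<and>
     (\<forall>i<n. \<forall>j<n. cmod (H $$ (i, j)) = 1) \<and>
     (\<forall>i<n. \<forall>j<n. i \<noteq> j \<longrightarrow> row H i \<bullet>c row H j = 0)"

text \<open>The block matrix of size \<open>m * k\<close> with \<open>k * k\<close> blocks of size \<open>m * m\<close>, whose block
  \<open>(i, j)\<close> is \<open>A\<^sub>i\<^sub>j B\<^sub>j\<close>. For an index \<open>i\<close>, the block number is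
  \<open>i div m\<close> and the position inside the block is \<open>i mod m\<close>.\<close>

definition dita_mat :: "nat \<Rightarrow> nat \<Rightarrow> complex mat \<Rightarrow> (nat \<Rightarrow> complex mat) \<Rightarrow> complex mat" where
  "dita_mat k m A B = mat (m * k) (m * k)
     (\<lambda>(i, j). A $$ (i div m, j div m) * B (j div m) $$ (i mod m, j mod m))"

definition mat_unit :: "nat \<Rightarrow> nat \<Rightarrow> nat \<Rightarrow> complex mat" where
  "mat_unit n i j = mat n n (\<lambda>p. if p = (i, j) then 1 else 0)"

text \<open>The identification of \<open>M\<^sub>n \<otimes> M\<^sub>n\<close> with the matrices of size \<open>n\<^sup>2\<close>: here the
  second tensor factor selects the block and the first one the position inside the block
  (the opposite of the usual Kronecker product convention); see \<open>tensor_mat_unit\<close>.\<close>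

definition tensor_mat :: "nat \<Rightarrow> complex mat \<Rightarrow> complex mat \<Rightarrow> complex mat" where
  "tensor_mat n x y = mat (n * n) (n * n)
     (\<lambda>(r, c). x $$ (r mod n, c mod n) * y $$ (r div n, c div n))"

lemma tensor_mat_unit:
  assumes "i < n" "j < n" "k < n" "l < n"
  shows "tensor_mat n (mat_unit n k l) (mat_unit n i j) = mat_unit (n * n) (i * n + k) (j * n + l)"
proof (rule eq_matI)
  fix r c
  assume "r < dim_row (mat_unit (n * n) (i * n + k) (j * n + l))"
    and "c < dim_col (mat_unit (n * n) (i * n + k) (j * n + l))"
  then have rc: "r < n * n" "c < n * n" by (simp_all add: mat_unit_def)
  have n: "0 < n" using assms by simp
  have "r mod n < n" "c mod n < n" "r div n < n" "c div n < n"
    using rc n by (simp_all add: less_mult_imp_div_less)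
  moreover have "r = i * n + k \<longleftrightarrow> r div n = i \<and> r mod n = k"
    using assms n by (metis div_mult_mod_eq div_mult_self3 div_less mod_mult_self3 mod_less
        add.right_neutral less_not_refl)
  moreover have "c = j * n + l \<longleftrightarrow> c div n = j \<and> c mod n = l"
    using assms n by (metis div_mult_mod_eq div_mult_self3 div_less mod_mult_self3 mod_less
        add.right_neutral less_not_refl)
  ultimately show "tensor_mat n (mat_unit n k l) (mat_unit n i j) $$ (r, c) =
      mat_unit (n * n) (i * n + k) (j * n + l) $$ (r, c)"
    using rc by (simp add: tensor_mat_def mat_unit_def)
qed (simp_all add: tensor_mat_def mat_unit_def)

abbreviation mat_sum :: "nat \<Rightarrow> ('i \<Rightarrow> complex mat) \<Rightarrow> 'i set \<Rightarrow> complex mat" where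
  "mat_sum N \<equiv> finsum (ring_mat TYPE(complex) N ())"

definition star_subalgebra :: "nat \<Rightarrow> complex mat set \<Rightarrow> bool" where
  "star_subalgebra N S \<longleftrightarrow>
     S \<subseteq> carrier_mat N N \<and> 0\<^sub>m N N \<in> S \<and>
     (\<forall>x\<in>S. \<forall>y\<in>S. x + y \<in> S) \<and>
     (\<forall>c. \<forall>x\<in>S. c \<cdot>\<^sub>m x \<in> S) \<and>
     (\<forall>x\<in>S. \<forall>y\<in>S. x * y \<in> S) \<and>
     (\<forall>x\<in>S. mat_adjoint x \<in> S)"

definition commutant :: "nat \<Rightarrow> complex mat set \<Rightarrow> complex mat set" where
  "commutant N S = {x \<in> carrier_mat N N. \<forall>y\<in>S. x * y = y * x}"

definition is_projection :: "nat \<Rightarrow> complex mat \<Rightarrow> bool" where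
  "is_projection N p \<longleftrightarrow> p \<in> carrier_mat N N \<and> p * p = p \<and> mat_adjoint p = p"

definition diag_algebra :: "nat \<Rightarrow> complex mat set" where
  "diag_algebra n = {d \<in> carrier_mat n n. diagonal_mat d}"

definition hadamard_unitary :: "nat \<Rightarrow> complex mat \<Rightarrow> complex mat" where
  "hadamard_unitary n H = complex_of_real (1 / sqrt (real n)) \<cdot>\<^sub>m H"

definition conj_diag_algebra :: "nat \<Rightarrow> complex mat \<Rightarrow> complex mat set" where
  "conj_diag_algebra n H =
     (\<lambda>d. hadamard_unitary n H * d * mat_adjoint (hadamard_unitary n H)) ` diag_algebra n"

definition embed_mat :: "nat \<Rightarrow> complex mat \<Rightarrow> complex mat" where
  "embed_mat n x = tensor_mat n x (1\<^sub>m n)"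

definition jones_e3 :: "nat \<Rightarrow> complex mat" where
  "jones_e3 n = mat_sum (n * n) (\<lambda>i. tensor_mat n (mat_unit n i i) (mat_unit n i i)) {..<n}"

text \<open>The *-algebra generated by \<open>U D\<^sub>n U\<^sup>*\<close> (embedded by \<open>x \<mapsto> x \<otimes> I\<^sub>n\<close>) and \<open>e\<^sub>3\<close>. For a
  Hadamard matrix, \<open>U D\<^sub>n U\<^sup>*\<close> contains the identity, so unital and non-unital generation agree.\<close>

definition Q1_algebra :: "nat \<Rightarrow> complex mat \<Rightarrow> complex mat set" where
  "Q1_algebra n H =
     star_subalgebra (n * n) hull (insert (jones_e3 n) (embed_mat n ` conj_diag_algebra n H))"

text \<open>The second relative commutant of the subfactor \<open>N\<^sub>H \<subseteq> M\<^sub>H\<close>, in its finite-dimensional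
  realization \<open>D\<^sub>n' \<inter> Q\<^sub>1\<close> given by Ocneanu's compactness theorem.\<close>

definition second_relative_commutant :: "nat \<Rightarrow> complex mat \<Rightarrow> complex mat set" where
  "second_relative_commutant n H =
     commutant (n * n) (embed_mat n ` diag_algebra n) \<inter> Q1_algebra n H"

end

theory Submission
  imports Defs
begin

text \<open>Why the theorem holds. For a block number \<open>c < k\<close> let \<open>P\<^sub>c = U D\<^sub>c U\<^sup>*\<close>, where \<open>D\<^sub>c\<close> is the
  diagonal projection onto the \<open>m\<close> coordinates of block \<open>c\<close>. Summing over the columns of that
  block and using that the rows of \<open>B\<^sub>c\<close> are orthogonal makes the dependence on \<open>B\<^sub>c\<close> disappear:
  in terms of the position \<open>a\<^sub>0\<close> inside a block and the block number \<open>a\<^sub>1\<close>, the \<open>(a, b)\<close> entry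
  of \<open>P\<^sub>c\<close> is \<open>\<delta>(a\<^sub>0, b\<^sub>0) A(a\<^sub>1, c) cnj (A(b\<^sub>1, c)) / k\<close> (lemma \<open>block_projection_index\<close>).

  The Jones projection cuts down a product: \<open>(x \<otimes> I) e\<^sub>3 (y \<otimes> I)\<close> is block diagonal, and its block
  number \<open>s\<close> is the matrix \<open>x e\<^sub>s\<^sub>s y\<close> (lemma \<open>embed_jones_embed\<close>). For
  \<open>x = y = P\<^sub>c\<close> the \<open>(a, b)\<close> entry of that block contains the factor
  \<open>\<bar>A(s\<^sub>1, c)\<bar>\<^sup>2 = 1\<close>, so it depends on \<open>s\<close> only through \<open>s\<^sub>0\<close>. Summing over \<open>c\<close>
  and using the orthogonality of the rows of \<open>A\<close> turns what is left into \<open>\<delta>(a\<^sub>1, b\<^sub>1)\<close>. Hence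
  \<open>f = k \<Sum>\<^sub>c P\<^sub>c e\<^sub>3 P\<^sub>c\<close> (lemma \<open>residue_diag_eq_sum\<close>), which is visibly an element of the algebra
  generated by \<open>U D\<^sub>n U\<^sup>*\<close> and \<open>e\<^sub>3\<close>. As \<open>f\<close> is itself a diagonal matrix of zeros and ones, it is a
  projection and commutes with \<open>D\<^sub>n\<close>.\<close>

section \<open>Finite sums of matrices\<close>

lemma mat_sum_insert:
  assumes "finite X" "x \<notin> X" "\<And>y. y \<in> insert x X \<Longrightarrow> g y \<in> carrier_mat N N"
  shows "mat_sum N g (insert x X) = g x + mat_sum N g X"
proof -
  interpret semiring "ring_mat TYPE(complex) N ()" by (rule semiring_mat)
  show ?thesis
    using finsum_insert[of X x g] assms by (auto simp: ring_mat_simps)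
qed

lemma mat_sum_empty: "mat_sum N g {} = 0\<^sub>m N N"
proof -
  interpret semiring "ring_mat TYPE(complex) N ()" by (rule semiring_mat)
  show ?thesis
    using finsum_empty[of g] by (simp add: ring_mat_simps)
qed

lemma mat_sum_closed:
  assumes "finite X" "\<And>x. x \<in> X \<Longrightarrow> g x \<in> carrier_mat N N"
  shows "mat_sum N g X \<in> carrier_mat N N"
  using assms
proof (induction X)
  case (insert x X)
  have "mat_sum N g (insert x X) = g x + mat_sum N g X"
    using insert.prems by (intro mat_sum_insert insert.hyps)
  with insert show ?case by simp
qed (simp add: mat_sum_empty)

lemma mat_sum_index:
  assumes "finite X" "\<And>x. x \<in> X \<Longrightarrow> g x \<in> carrier_mat N N" "r < N" "c < N"
  shows "mat_sum N g X $$ (r, c) = (\<Sum>x\<in>X. g x $$ (r, c))"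
  using assms
proof (induction X)
  case (insert x X)
  have "mat_sum N g X \<in> carrier_mat N N"
    using insert by (intro mat_sum_closed) auto
  moreover have "mat_sum N g (insert x X) = g x + mat_sum N g X"
    using insert.prems by (intro mat_sum_insert insert.hyps) blast
  ultimately show ?case using insert by simp
qed (simp add: mat_sum_empty)

lemma star_subalgebra_mat_sum:
  assumes "star_subalgebra N S" "finite X" "\<And>x. x \<in> X \<Longrightarrow> g x \<in> S"
  shows "mat_sum N g X \<in> S"
  using assms(2,3)
proof (induction X)
  case empty
  with assms(1) show ?case by (simp add: mat_sum_empty star_subalgebra_def)
next
  case (insert x X)
  have "S \<subseteq> carrier_mat N N" using assms(1) by (simp add: star_subalgebra_def)
  with insert.prems have "mat_sum N g (insert x X) = g x + mat_sum N g X"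
    by (intro mat_sum_insert insert.hyps) blast
  with insert assms(1) show ?case by (simp add: star_subalgebra_def)
qed

section \<open>Diagonal matrices in the tensor square\<close>

lemma mat_adjoint_index:
  assumes "i < dim_col A" "j < dim_row A"
  shows "mat_adjoint A $$ (i, j) = cnj (A $$ (j, i))"
  using assms by (simp add: mat_adjoint_def mat_of_rows_index)

lemma mat_adjoint_dim [simp]:
  "dim_row (mat_adjoint A) = dim_col A" "dim_col (mat_adjoint A) = dim_row A"
  by (simp_all add: mat_adjoint_def)

lemma tensor_mat_carrier [simp]: "tensor_mat n x y \<in> carrier_mat (n * n) (n * n)"
  by (simp add: tensor_mat_def)

lemma div_mod_less_square:
  fixes r n :: nat
  assumes "r < n * n"
  shows "r div n < n" "r mod n < n"
proof -
  have "0 < n" using assms by (cases n) auto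
  then show "r div n < n" "r mod n < n"
    using assms by (simp_all add: less_mult_imp_div_less)
qed

text \<open>Both \<open>e\<^sub>3\<close> and \<open>f\<close> are sums of distinct minimal diagonal projections
  \<open>e\<^sub>i\<^sub>i \<otimes> e\<^sub>j\<^sub>j\<close>. A diagonal position \<open>r\<close> belongs to the one with \<open>i = r mod n\<close> and
  \<open>j = r div n\<close>, because the first tensor factor is the position inside a block.\<close>

lemma mat_sum_diag_units:
  assumes fin: "finite I" and inj: "inj_on (\<lambda>i. (a i, b i)) I"
  shows "mat_sum (n * n)
           (\<lambda>i. tensor_mat n (mat_unit n (a i) (a i)) (mat_unit n (b i) (b i))) I =
         mat_diag (n * n) (\<lambda>r. of_bool (\<exists>i\<in>I. r mod n = a i \<and> r div n = b i))"
    (is "mat_sum _ ?g _ = mat_diag _ ?d")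
proof (rule eq_matI)
  have carr: "mat_sum (n * n) ?g I \<in> carrier_mat (n * n) (n * n)"
    using fin by (intro mat_sum_closed) auto
  then show "dim_row (mat_sum (n * n) ?g I) = dim_row (mat_diag (n * n) ?d)"
    "dim_col (mat_sum (n * n) ?g I) = dim_col (mat_diag (n * n) ?d)"
    by (simp_all add: mat_diag_def)
  fix r c
  assume "r < dim_row (mat_diag (n * n) ?d)" "c < dim_col (mat_diag (n * n) ?d)"
  then have rc: "r < n * n" "c < n * n" by (simp_all add: mat_diag_def)
  note bounds = div_mod_less_square[OF rc(1)] div_mod_less_square[OF rc(2)]
  have eq: "r = c \<longleftrightarrow> r mod n = c mod n \<and> r div n = c div n"
    by (metis div_mult_mod_eq)
  have entry: "?g i $$ (r, c) = (if r = c \<and> r mod n = a i \<and> r div n = b i then 1 else 0)" for i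
    using rc bounds eq by (auto simp: tensor_mat_def mat_unit_def)
  have "mat_sum (n * n) ?g I $$ (r, c) =
      (\<Sum>i\<in>I. if r = c \<and> r mod n = a i \<and> r div n = b i then 1 else 0)"
    using fin rc by (simp add: mat_sum_index entry)
  also have "\<dots> = (if r = c then ?d c else 0)"
  proof (cases "\<exists>i\<in>I. r mod n = a i \<and> r div n = b i")
    case True
    then obtain i0 where i0: "i0 \<in> I" "r mod n = a i0" "r div n = b i0" by blast
    have "r mod n = a i \<and> r div n = b i \<longleftrightarrow> i = i0" if "i \<in> I" for i
      using inj that i0 by (auto dest: inj_onD)
    then have "(\<Sum>i\<in>I. if r = c \<and> r mod n = a i \<and> r div n = b i then 1 else 0) =
        (\<Sum>i\<in>I. if i = i0 then (if r = c then 1 else 0 :: complex) else 0)"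
      by (intro sum.cong) auto
    with True fin i0(1) show ?thesis by (auto simp: sum.delta')
  next
    case False
    then show ?thesis by (auto intro!: sum.neutral)
  qed
  finally show "mat_sum (n * n) ?g I $$ (r, c) = mat_diag (n * n) ?d $$ (r, c)"
    using rc by (simp add: mat_diag_def)
qed

lemma jones_e3_eq_diag: "jones_e3 n = mat_diag (n * n) (\<lambda>r. of_bool (r mod n = r div n))"
proof -
  have "jones_e3 n = mat_diag (n * n) (\<lambda>r. of_bool (\<exists>i\<in>{..<n}. r mod n = i \<and> r div n = i))"
    unfolding jones_e3_def by (rule mat_sum_diag_units) (auto simp: inj_on_def)
  also have "\<dots> = mat_diag (n * n) (\<lambda>r. of_bool (r mod n = r div n))"
    by (rule eq_matI) (auto simp: mat_diag_def div_mod_less_square)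
  finally show ?thesis .
qed

lemma mat_sum_residue_eq_diag:
  fixes m n :: nat
  shows "mat_sum (n * n) (\<lambda>(i, j). tensor_mat n (mat_unit n i i) (mat_unit n j j))
      {(i, j). i < n \<and> j < n \<and> [i = j] (mod m)} =
    mat_diag (n * n) (\<lambda>r. of_bool ([r mod n = r div n] (mod m)))"
    (is "mat_sum _ _ ?X = _")
proof -
  have "finite ?X" by (rule finite_subset[of _ "{..<n} \<times> {..<n}"]) auto
  then have "mat_sum (n * n) (\<lambda>(i, j). tensor_mat n (mat_unit n i i) (mat_unit n j j)) ?X =
      mat_diag (n * n) (\<lambda>r. of_bool (\<exists>p\<in>?X. r mod n = fst p \<and> r div n = snd p))"
    unfolding case_prod_unfold by (intro mat_sum_diag_units) (auto simp: inj_on_def)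
  also have "\<dots> = mat_diag (n * n) (\<lambda>r. of_bool ([r mod n = r div n] (mod m)))"
    by (rule eq_matI) (auto simp: mat_diag_def div_mod_less_square)
  finally show ?thesis .
qed

lemma is_projection_mat_diag_of_bool: "is_projection N (mat_diag N (\<lambda>r. of_bool (Q r)))"
proof -
  have "mat_adjoint (mat_diag N (\<lambda>r. of_bool (Q r))) =
      (mat_diag N (\<lambda>r. of_bool (Q r)) :: complex mat)"
    by (rule eq_matI) (auto simp: mat_adjoint_index mat_diag_def)
  then show ?thesis by (simp add: is_projection_def flip: of_bool_conj)
qed

lemma mat_diag_in_commutant_diag:
  "mat_diag (n * n) g \<in> commutant (n * n) (embed_mat n ` diag_algebra n)"
proof -
  have "mat_diag (n * n) g * embed_mat n d = embed_mat n d * mat_diag (n * n) g"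
    if d: "d \<in> diag_algebra n" for d
  proof -
    have "embed_mat n d = mat_diag (n * n) (\<lambda>r. d $$ (r mod n, r mod n))"
    proof (rule eq_matI)
      fix r c
      assume "r < dim_row (mat_diag (n * n) (\<lambda>r. d $$ (r mod n, r mod n)))"
        "c < dim_col (mat_diag (n * n) (\<lambda>r. d $$ (r mod n, r mod n)))"
      then have rc: "r < n * n" "c < n * n" by (simp_all add: mat_diag_def)
      have "r = c \<longleftrightarrow> r mod n = c mod n \<and> r div n = c div n"
        by (metis div_mult_mod_eq)
      then show "embed_mat n d $$ (r, c) = mat_diag (n * n) (\<lambda>r. d $$ (r mod n, r mod n)) $$ (r, c)"
        using rc d div_mod_less_square[OF rc(1)] div_mod_less_square[OF rc(2)]
        by (auto simp: embed_mat_def tensor_mat_def mat_diag_def diag_algebra_def diagonal_mat_def)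
    qed (simp_all add: embed_mat_def tensor_mat_def mat_diag_def)
    then show ?thesis by (simp add: mult.commute)
  qed
  then show ?thesis by (auto simp: commutant_def)
qed

section \<open>Compressing by the Jones projection\<close>

text \<open>This is the identity \<open>(x \<otimes> I) e\<^sub>3 (y \<otimes> I) = \<Sum>\<^sub>s x e\<^sub>s\<^sub>s y \<otimes> e\<^sub>s\<^sub>s\<close>
  read off entry by entry.\<close>

lemma embed_jones_embed:
  "embed_mat n x * jones_e3 n * embed_mat n y = mat (n * n) (n * n)
     (\<lambda>(r, c). if r div n = c div n
               then x $$ (r mod n, r div n) * y $$ (r div n, c mod n) else 0)"
    (is "_ = ?M")
proof (rule eq_matI)
  fix r c
  assume "r < dim_row ?M" "c < dim_col ?M"
  then have rc: "r < n * n" "c < n * n" by simp_all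
  note bounds = div_mod_less_square[OF rc(1)] div_mod_less_square[OF rc(2)]
  define s where "s = r div n"
  have s: "s < n" using bounds by (simp add: s_def)
  define t0 where "t0 = s * n + s"
  have t0_dm: "t0 div n = s" "t0 mod n = s" using s by (simp_all add: t0_def)
  have "t0 < Suc s * n" using s by (simp add: t0_def)
  also have "\<dots> \<le> n * n" using s by (intro mult_right_mono) auto
  finally have t0: "t0 < n * n" .
  let ?E = "\<lambda>x r c. x $$ (r mod n, c mod n) * (if r div n = c div n then 1 else 0 :: complex)"
  have E: "embed_mat n z $$ (i, j) = ?E z i j" if "i < n * n" "j < n * n" for z i j
    using that div_mod_less_square[of i n] div_mod_less_square[of j n]
    by (simp add: embed_mat_def tensor_mat_def)
  have carr: "embed_mat n z \<in> carrier_mat (n * n) (n * n)" for z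
    by (simp add: embed_mat_def)
  then have dims: "dim_row (embed_mat n z) = n * n" "dim_col (embed_mat n z) = n * n" for z
    by blast+
  have "(embed_mat n x * jones_e3 n * embed_mat n y) $$ (r, c) =
      (\<Sum>t<n * n. ?E x r t * of_bool (t mod n = t div n) * ?E y t c)"
    using rc
    by (simp add: jones_e3_eq_diag mat_diag_mult_right[OF carr] scalar_prod_def dims E
        lessThan_atLeast0)
  \<comment> \<open>The block of \<open>r\<close> fixes \<open>t div n = s\<close>, and \<open>e\<^sub>3\<close> then forces \<open>t mod n = s\<close>: one term survives.\<close>
  also have "\<dots> = (\<Sum>t<n * n. if t = t0 then ?E x r t0 * ?E y t0 c else 0)"
  proof (rule sum.cong)
    fix t
    have "t = t0 \<longleftrightarrow> r div n = t div n \<and> t mod n = t div n"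
      using t0_dm by (metis div_mult_mod_eq s_def)
    then show "?E x r t * of_bool (t mod n = t div n) * ?E y t c =
        (if t = t0 then ?E x r t0 * ?E y t0 c else 0)"
      by (auto simp: t0_dm)
  qed simp
  also have "\<dots> = ?M $$ (r, c)"
    using rc t0 by (simp add: t0_dm s_def)
  finally show "(embed_mat n x * jones_e3 n * embed_mat n y) $$ (r, c) = ?M $$ (r, c)" .
qed (simp_all add: embed_mat_def tensor_mat_def)

section \<open>Block projections of a Dita type matrix\<close>

text \<open>Only the orthogonality of rows is part of the definition; the value for equal rows comes
  from the entries having absolute value one.\<close>

lemma complex_hadamard_row_sum:
  assumes H: "complex_hadamard n H" and ij: "i < n" "j < n"
  shows "(\<Sum>t<n. H $$ (i, t) * cnj (H $$ (j, t))) = (if i = j then of_nat n else 0)"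
proof (cases "i = j")
  case True
  have "H $$ (i, t) * cnj (H $$ (i, t)) = 1" if "t < n" for t
    using H ij that by (simp add: complex_hadamard_def complex_norm_square[symmetric])
  with True show ?thesis by simp
next
  case False
  have "H \<in> carrier_mat n n" "row H i \<bullet>c row H j = 0"
    using H ij False by (auto simp: complex_hadamard_def)
  with False ij show ?thesis
    by (auto simp: scalar_prod_def lessThan_atLeast0)
qed

text \<open>The projection \<open>U D\<^sub>c U\<^sup>*\<close> onto the span of the columns of the unitary that lie in the
  block column \<open>c\<close>.\<close>

definition block_projection :: "nat \<Rightarrow> nat \<Rightarrow> complex mat \<Rightarrow> nat \<Rightarrow> complex mat" where
  "block_projection m n H c = hadamard_unitary n H * mat_diag n (\<lambda>j. of_bool (j div m = c)) *
     mat_adjoint (hadamard_unitary n H)"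

lemma block_projection_in_conj_diag_algebra:
  "block_projection m n H c \<in> conj_diag_algebra n H"
  unfolding block_projection_def conj_diag_algebra_def diag_algebra_def
  by (rule imageI) (auto simp: diagonal_mat_def mat_diag_def)

text \<open>The columns of block \<open>c\<close> are \<open>c m + t\<close> with \<open>t < m\<close>; along them the factors from \<open>A\<close> are
  constant, and the factors from \<open>B\<^sub>c\<close> sum to an inner product of two rows of \<open>B\<^sub>c\<close>.\<close>

lemma block_projection_index:
  assumes m: "0 < m" and n: "n = m * k"
    and B: "complex_hadamard m (B c)"
    and H: "H = dita_mat k m A B"
    and c: "c < k" and ab: "a < n" "b < n"
  shows "block_projection m n H c $$ (a, b) =
    (if a mod m = b mod m then A $$ (a div m, c) * cnj (A $$ (b div m, c)) / of_nat k else 0)"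
proof -
  have k: "0 < k" using c by simp
  have dims: "H \<in> carrier_mat n n"
    by (simp add: H n dita_mat_def)
  let ?U = "hadamard_unitary n H"
  have U: "?U \<in> carrier_mat n n" using dims by (simp add: hadamard_unitary_def)
  have Uij: "?U $$ (i, j) = complex_of_real (1 / sqrt (real n)) * H $$ (i, j)"
    if "i < n" "j < n" for i j
    using dims that by (simp add: hadamard_unitary_def)
  have root: "complex_of_real (1 / sqrt (real n)) * complex_of_real (1 / sqrt (real n)) =
      1 / of_nat n"
  proof -
    have "1 / sqrt (real n) * (1 / sqrt (real n)) = 1 / real n" by simp
    then show ?thesis by (metis of_real_mult of_real_divide of_real_1 of_real_of_nat_eq)
  qed
  have "block_projection m n H c $$ (a, b) =
      (\<Sum>j<n. ?U $$ (a, j) * of_bool (j div m = c) * cnj (?U $$ (b, j)))"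
    using ab U
    by (simp add: block_projection_def mat_diag_mult_right[OF U] scalar_prod_def
        mat_adjoint_index lessThan_atLeast0)
  also have "\<dots> = (\<Sum>j<n. if j div m = c then H $$ (a, j) * cnj (H $$ (b, j)) / of_nat n else 0)"
  proof (rule sum.cong)
    fix j assume "j \<in> {..<n}"
    then have "?U $$ (a, j) * cnj (?U $$ (b, j)) =
        (complex_of_real (1 / sqrt (real n)) * complex_of_real (1 / sqrt (real n))) *
        (H $$ (a, j) * cnj (H $$ (b, j)))"
      using ab by (simp add: Uij)
    then show "?U $$ (a, j) * of_bool (j div m = c) * cnj (?U $$ (b, j)) =
        (if j div m = c then H $$ (a, j) * cnj (H $$ (b, j)) / of_nat n else 0)"
      unfolding root by simp
  qed simp
  also have "\<dots> = (\<Sum>j\<in>{j. j < n \<and> j div m = c}. H $$ (a, j) * cnj (H $$ (b, j)) / of_nat n)"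
    by (rule sum.mono_neutral_cong_right) auto
  also have "\<dots> = (\<Sum>t<m. H $$ (a, c * m + t) * cnj (H $$ (b, c * m + t)) / of_nat n)"
  proof (rule sum.reindex_bij_witness[of _ "\<lambda>t. c * m + t" "\<lambda>j. j mod m"])
    fix t assume t: "t \<in> {..<m}"
    then have "c * m + t < Suc c * m" by simp
    also have "\<dots> \<le> k * m" using c by (intro mult_right_mono) auto
    finally show "c * m + t \<in> {j. j < n \<and> j div m = c}"
      using t by (simp add: n mult.commute)
  qed (use m in auto)
  also have "\<dots> = (\<Sum>t<m. A $$ (a div m, c) * cnj (A $$ (b div m, c)) / of_nat n *
      (B c $$ (a mod m, t) * cnj (B c $$ (b mod m, t))))"
  proof (rule sum.cong)
    fix t assume t: "t \<in> {..<m}"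
    then have "c * m + t < Suc c * m" by simp
    also have "\<dots> \<le> k * m" using c by (intro mult_right_mono) auto
    finally have "c * m + t < m * k" by (simp add: mult.commute)
    with t ab show "H $$ (a, c * m + t) * cnj (H $$ (b, c * m + t)) / of_nat n =
        A $$ (a div m, c) * cnj (A $$ (b div m, c)) / of_nat n *
        (B c $$ (a mod m, t) * cnj (B c $$ (b mod m, t)))"
      by (simp add: H dita_mat_def n)
  qed simp
  also have "\<dots> = A $$ (a div m, c) * cnj (A $$ (b div m, c)) / of_nat n *
      (if a mod m = b mod m then of_nat m else 0)"
    unfolding sum_distrib_left[symmetric]
    using m by (subst complex_hadamard_row_sum[OF B]) auto
  also have "\<dots> = (if a mod m = b mod m
      then A $$ (a div m, c) * cnj (A $$ (b div m, c)) / of_nat k else 0)"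
    using m k by (simp add: n)
  finally show ?thesis .
qed

section \<open>The projection as an element of the generated algebra\<close>

text \<open>In the entry of \<open>P\<^sub>c e\<^sub>3 P\<^sub>c\<close> at block \<open>s\<close> the two factors at row \<open>s div m\<close> of \<open>A\<close>
  cancel, as they are conjugate numbers of absolute value one. This is why the same index \<open>c\<close> is
  taken on both sides of \<open>e\<^sub>3\<close>. Each \<open>P\<^sub>c\<close> carries a factor \<open>1 / k\<close>, and the row sum of \<open>A\<close> returns
  one factor \<open>k\<close>; the scalar in front makes up for the other.\<close>

lemma residue_diag_eq_sum:
  fixes n m k :: nat
  assumes m: "0 < m" and k: "0 < k" and n: "n = m * k"
    and A: "complex_hadamard k A"
    and B: "\<And>j. j < k \<Longrightarrow> complex_hadamard m (B j)"
    and H: "H = dita_mat k m A B"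
  shows "mat_diag (n * n) (\<lambda>r. of_bool ([r mod n = r div n] (mod m))) =
    of_nat k \<cdot>\<^sub>m mat_sum (n * n)
      (\<lambda>c. embed_mat n (block_projection m n H c) * jones_e3 n *
           embed_mat n (block_projection m n H c)) {..<k}"
    (is "?f = of_nat k \<cdot>\<^sub>m mat_sum _ ?g _")
proof (rule eq_matI)
  have gc: "?g c \<in> carrier_mat (n * n) (n * n)" for c
    by (simp add: embed_jones_embed)
  then have carr: "mat_sum (n * n) ?g {..<k} \<in> carrier_mat (n * n) (n * n)"
    by (intro mat_sum_closed) auto
  then show "dim_row ?f = dim_row (of_nat k \<cdot>\<^sub>m mat_sum (n * n) ?g {..<k})"
    "dim_col ?f = dim_col (of_nat k \<cdot>\<^sub>m mat_sum (n * n) ?g {..<k})"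
    by (simp_all add: mat_diag_def)
  fix r q
  assume "r < dim_row (of_nat k \<cdot>\<^sub>m mat_sum (n * n) ?g {..<k})"
    "q < dim_col (of_nat k \<cdot>\<^sub>m mat_sum (n * n) ?g {..<k})"
  then have rq: "r < n * n" "q < n * n" using carr by auto
  define s a b where "s = r div n" and "a = r mod n" and "b = q mod n"
  have sab: "s < n" "a < n" "b < n"
    using rq by (simp_all add: s_def a_def b_def div_mod_less_square)
  have blocks: "s div m < k" "a div m < k" "b div m < k"
    using sab by (simp_all add: n less_mult_imp_div_less mult.commute)
  define C where "C \<longleftrightarrow> r div n = q div n \<and> a mod m = s mod m \<and> s mod m = b mod m"
  have entry: "?g c $$ (r, q) =
      (if C then A $$ (a div m, c) * cnj (A $$ (b div m, c)) / (of_nat k * of_nat k) else 0)"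
    if c: "c < k" for c
  proof -
    have unit: "A $$ (s div m, c) * cnj (A $$ (s div m, c)) = 1"
      using A blocks c by (simp add: complex_hadamard_def complex_norm_square[symmetric])
    have "?g c $$ (r, q) = (if r div n = q div n
        then block_projection m n H c $$ (a, s) * block_projection m n H c $$ (s, b) else 0)"
      using rq by (simp add: embed_jones_embed s_def a_def b_def)
    also have "\<dots> = (if C then (A $$ (a div m, c) * cnj (A $$ (s div m, c)) / of_nat k) *
        (A $$ (s div m, c) * cnj (A $$ (b div m, c)) / of_nat k) else 0)"
      using sab by (simp add: C_def block_projection_index[where B = B and A = A, OF m n B[OF c] H c])
    also have "\<dots> = (if C then (A $$ (s div m, c) * cnj (A $$ (s div m, c))) *
        (A $$ (a div m, c) * cnj (A $$ (b div m, c)) / (of_nat k * of_nat k)) else 0)"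
      by simp
    finally show ?thesis unfolding unit by simp
  qed
  have "(of_nat k \<cdot>\<^sub>m mat_sum (n * n) ?g {..<k}) $$ (r, q) = of_nat k * (\<Sum>c<k. ?g c $$ (r, q))"
    using rq carr gc by (simp add: mat_sum_index)
  also have "(\<Sum>c<k. ?g c $$ (r, q)) =
      (if C then (\<Sum>c<k. A $$ (a div m, c) * cnj (A $$ (b div m, c))) / (of_nat k * of_nat k)
       else 0)"
    by (simp add: entry sum_divide_distrib)
  also have "of_nat k * \<dots> = (if C \<and> a div m = b div m then 1 else 0)"
    using k blocks by (simp add: complex_hadamard_row_sum[OF A])
  also have "\<dots> = (if r = q \<and> a mod m = s mod m then 1 else 0)"
  proof -
    have "a = b \<longleftrightarrow> a mod m = b mod m \<and> a div m = b div m"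
      by (metis div_mult_mod_eq)
    moreover have "r = q \<longleftrightarrow> r div n = q div n \<and> a = b"
      unfolding a_def b_def by (metis div_mult_mod_eq)
    ultimately show ?thesis by (auto simp: C_def)
  qed
  also have "\<dots> = ?f $$ (r, q)"
    using rq by (auto simp: mat_diag_def cong_def a_def s_def)
  finally show "?f $$ (r, q) = (of_nat k \<cdot>\<^sub>m mat_sum (n * n) ?g {..<k}) $$ (r, q)" ..
qed

lemma jones_sum_in_Q1_algebra:
  assumes "finite X" "\<And>c. c \<in> X \<Longrightarrow> p c \<in> conj_diag_algebra n H"
  shows "z \<cdot>\<^sub>m mat_sum (n * n) (\<lambda>c. embed_mat n (p c) * jones_e3 n * embed_mat n (p c)) X
         \<in> Q1_algebra n H"
  unfolding Q1_algebra_def hull_def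
proof (rule InterI, elim CollectE conjE)
  fix S
  assume S: "star_subalgebra (n * n) S"
    and gen: "insert (jones_e3 n) (embed_mat n ` conj_diag_algebra n H) \<subseteq> S"
  have "embed_mat n (p c) * jones_e3 n * embed_mat n (p c) \<in> S" if "c \<in> X" for c
    using S gen assms(2)[OF that] by (auto simp: star_subalgebra_def)
  then have "mat_sum (n * n) (\<lambda>c. embed_mat n (p c) * jones_e3 n * embed_mat n (p c)) X \<in> S"
    by (intro star_subalgebra_mat_sum[OF S assms(1)])
  with S show "z \<cdot>\<^sub>m mat_sum (n * n) (\<lambda>c. embed_mat n (p c) * jones_e3 n * embed_mat n (p c)) X \<in> S"
    by (simp add: star_subalgebra_def)
qed

theorem proposition3p1:
  fixes k m n :: nat and A H f :: "complex mat" and B :: "nat \<Rightarrow> complex mat"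
  assumes "k \<ge> 2" and "m \<ge> 2" and "n = m * k"
    and "complex_hadamard k A"
    and "\<And>j. j < k \<Longrightarrow> complex_hadamard m (B j)"
    and "H = dita_mat k m A B"
    and "f = mat_sum (n * n)
               (\<lambda>(i, j). tensor_mat n (mat_unit n i i) (mat_unit n j j))
               {(i, j). i < n \<and> j < n \<and> [i = j] (mod m)}"
  shows "is_projection (n * n) f \<and> f \<in> second_relative_commutant n H"
proof -
  have f: "f = mat_diag (n * n) (\<lambda>r. of_bool ([r mod n = r div n] (mod m)))"
    using assms(7) by (simp only: mat_sum_residue_eq_diag)
  have "f = of_nat k \<cdot>\<^sub>m mat_sum (n * n)
      (\<lambda>c. embed_mat n (block_projection m n H c) * jones_e3 n *
           embed_mat n (block_projection m n H c)) {..<k}"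
    unfolding f using assms(1,2) by (intro residue_diag_eq_sum[OF _ _ assms(3-6)]) auto
  then have "f \<in> Q1_algebra n H"
    by (simp only: jones_sum_in_Q1_algebra block_projection_in_conj_diag_algebra finite_lessThan)
  then show ?thesis
    by (simp add: second_relative_commutant_def f mat_diag_in_commutant_diag
        is_projection_mat_diag_of_bool)
qed

end
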